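(* Let $F$ be Thompson's group with generators $x_0,x_1$, and let $D$ be the set of all dyadic rational numbers in $(0,1)$. The Schreier graph $\Gamma(F,\{x_0,x_1\},D)$ of the action of $F$ on $D$ is isomorphic, as an oriented graph with edges labelled by $x_0,x_1$, to the following graph. Its vertices are pairwise distinct symbols of four kinds, where $\{L,R\}^*$ denotes the set of finite words (including the empty word $\emptyset$) over $\{L,R\}$: (i) $p_k$ for $k\in\mathbb Z$; (ii) "gray" vertices $g_w$ for $w\in\{L,R\}^*$; (iii) "black" vertices $b_{w,k}$ for $w\in\{L,R\}^*$, $k\ge 1$; (iv) "white" vertices $c_{w,k}$ for $w\in\{L,R\}^*$, $k\ge1$. Its arrows labelled $x_0$ are exactly: $p_k\to p_{k+1}$ for all $k\in\mathbb Z$; and for every $w\in\{L,R\}^*$: $c_{w,k+1}\to c_{w,k}$ for $k\ge1$, $c_{w,1}\to g_w$, $g_w\to b_{w,1}$, and $b_{w,k}\to b_{w,k+1}$ for $k\ge1$. Its arrows labelled $x_1$ are exactly: a loop $p_k\to p_k$ for each $k\ge0$; $p_{-1}\to g_{\emptyset}$; $p_{-k-1}\to p_{-k}$ for $k\ge1$; and for every $w\in\{L,R\}^*$: $g_w\to g_{wL}$, $c_{w,1}\to g_{wR}$, $c_{w,k+1}\to c_{w,k}$ for $k\ge 1$, and a loop $b_{w,k}\to b_{w,k}$ for each $k\ge1$. Under this isomorphism the vertex $p_0$ corresponds to $\tfrac12\in D$.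
   Context: Thompson's group $F$ is the group of all strictly increasing piecewise linear homeomorphisms of $[0,1]$ that are differentiable except at finitely many dyadic rational numbers and whose derivatives on the intervals of differentiability are integer powers of $2$. Products are composed left to right: $(fg)(x)=g(f(x))$. $F$ is generated by $x_0,x_1$, where $x_0(t)=t/2$ on $[0,\frac12]$, $t-\frac14$ on $[\frac12,\frac34]$, $2t-1$ on $[\frac34,1]$; $x_1(t)=t$ on $[0,\frac12]$, $\frac t2+\frac14$ on $[\frac12,\frac34]$, $t-\frac18$ on $[\frac34,\frac78]$, $2t-1$ on $[\frac78,1]$. For a group $G$ with finite generating set $S$ acting on a set $M$, the Schreier graph $\Gamma(G,S,M)$ is the oriented labelled graph with vertex set $M$ and an arrow from $x$ to $y$ labelled $s\in S$ if and only if $s$ sends $x$ to $y$. Here $F$ acts on $D$ by evaluation, $d\mapsto f(d)$. *)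

theory Defs
  imports "HOL-Analysis.Analysis" "HOL-Algebra.Group"
begin

section \<open>Labelled oriented graphs and Schreier graphs\<close>

record ('v, 'l) lgraph =
  verts :: "'v set"
  arrows :: "('v \<times> 'l \<times> 'v) set"

definition lgraph_iso :: "('v, 'l) lgraph \<Rightarrow> ('w, 'l) lgraph \<Rightarrow> ('v \<Rightarrow> 'w) \<Rightarrow> bool" where
  "lgraph_iso X Y \<phi> \<longleftrightarrow>
     bij_betw \<phi> (verts X) (verts Y) \<and>
     (\<forall>x\<in>verts X. \<forall>y\<in>verts X. \<forall>s. (x, s, y) \<in> arrows X \<longleftrightarrow> (\<phi> x, s, \<phi> y) \<in> arrows Y)"

text \<open>Products are read from left to right, so the actions are right actions.\<close>

locale right_group_action = group G for G (structure) +
  fixes M :: "'m set" and act :: "'a \<Rightarrow> 'm \<Rightarrow> 'm"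
  assumes act_closed: "\<lbrakk>g \<in> carrier G; x \<in> M\<rbrakk> \<Longrightarrow> act g x \<in> M"
    and act_one: "x \<in> M \<Longrightarrow> act \<one> x = x"
    and act_mult: "\<lbrakk>g \<in> carrier G; h \<in> carrier G; x \<in> M\<rbrakk> \<Longrightarrow> act (g \<otimes> h) x = act h (act g x)"

definition schreier_graph ::
    "('g, 'x) monoid_scheme \<Rightarrow> 'g set \<Rightarrow> ('g \<Rightarrow> 'm \<Rightarrow> 'm) \<Rightarrow> 'm set \<Rightarrow> ('m, 'g) lgraph" where
  "schreier_graph G S act M =
     \<lparr>verts = M,
      arrows = {(x, s, y). x \<in> M \<and> y \<in> M \<and> s \<in> S \<and> s \<in> carrier G \<and> act s x = y}\<rparr>"


section \<open>Thompson's group F\<close>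

text \<open>The library's \<^const>\<open>dyadics\<close> is the set of non-negative dyadic rationals.\<close>

definition dyadics01 :: "real set" where
  "dyadics01 = dyadics \<inter> {0<..<1}"

text \<open>
  Homeomorphisms of the unit interval are represented by functions that are \<^const>\<open>undefined\<close>
  outside it.  The set \<open>A\<close> contains the points where \<open>f\<close> may fail to be differentiable: \<open>f\<close> is
  affine on every interval whose interior avoids \<open>A\<close>.  At \<open>0\<close> and \<open>1\<close> the derivative is one-sided.
\<close>

definition thompson_map :: "(real \<Rightarrow> real) \<Rightarrow> bool" where
  "thompson_map f \<longleftrightarrow>
     f \<in> extensional {0..1} \<and>
     (\<exists>g. homeomorphism {0..1} {0..1} f g) \<and>
     strict_mono_on {0..1} f \<and>
     (\<exists>A. finite A \<and> A \<subseteq> dyadics \<and>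
        (\<forall>a b. 0 \<le> a \<and> a < b \<and> b \<le> 1 \<and> {a<..<b} \<inter> A = {} \<longrightarrow>
           (\<exists>m c. \<forall>x\<in>{a..b}. f x = m * x + c)) \<and>
        (\<forall>x\<in>{0..1} - A. \<exists>k::int. (f has_real_derivative 2 powi k) (at x within {0..1})))"

definition thompson_F :: "(real \<Rightarrow> real) monoid" where
  "thompson_F =
     \<lparr>carrier = {f. thompson_map f},
      monoid.mult = (\<lambda>f g. compose {0..1} g f),
      one = (\<lambda>x\<in>{0..1}. x)\<rparr>"

definition thompson_x0 :: "real \<Rightarrow> real" where
  "thompson_x0 = (\<lambda>t\<in>{0..1}.
     if t \<le> 1/2 then t / 2
     else if t \<le> 3/4 then t - 1/4
     else 2 * t - 1)"

definition thompson_x1 :: "real \<Rightarrow> real" where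
  "thompson_x1 = (\<lambda>t\<in>{0..1}.
     if t \<le> 1/2 then t
     else if t \<le> 3/4 then t / 2 + 1/4
     else if t \<le> 7/8 then t - 1/8
     else 2 * t - 1)"


section \<open>The explicit graph\<close>

datatype letter = L | R

datatype vertex =
    P int
  | Gray "letter list"
  | Black "letter list" nat
  | White "letter list" nat

definition model_verts :: "vertex set" where
  "model_verts =
     range P \<union> range Gray \<union> {Black w k | w k. k \<ge> 1} \<union> {White w k | w k. k \<ge> 1}"

text \<open>The arguments \<open>a\<close> and \<open>b\<close> are the two edge labels; \<open>w @ [L]\<close> is the word \<open>wL\<close>.\<close>

inductive_set model_arrows :: "'l \<Rightarrow> 'l \<Rightarrow> (vertex \<times> 'l \<times> vertex) set" for a b :: 'l where
  a_P: "(P k, a, P (k + 1)) \<in> model_arrows a b"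
| a_White: "k \<ge> 1 \<Longrightarrow> (White w (k + 1), a, White w k) \<in> model_arrows a b"
| a_White1: "(White w 1, a, Gray w) \<in> model_arrows a b"
| a_Gray: "(Gray w, a, Black w 1) \<in> model_arrows a b"
| a_Black: "k \<ge> 1 \<Longrightarrow> (Black w k, a, Black w (k + 1)) \<in> model_arrows a b"
| b_P_nonneg: "k \<ge> 0 \<Longrightarrow> (P k, b, P k) \<in> model_arrows a b"
| b_P_minus1: "(P (- 1), b, Gray []) \<in> model_arrows a b"
| b_P_neg: "k \<ge> 1 \<Longrightarrow> (P (- k - 1), b, P (- k)) \<in> model_arrows a b"
| b_Gray: "(Gray w, b, Gray (w @ [L])) \<in> model_arrows a b"
| b_White1: "(White w 1, b, Gray (w @ [R])) \<in> model_arrows a b"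
| b_White: "k \<ge> 1 \<Longrightarrow> (White w (k + 1), b, White w k) \<in> model_arrows a b"
| b_Black: "k \<ge> 1 \<Longrightarrow> (Black w k, b, Black w k) \<in> model_arrows a b"

definition model_graph :: "'l \<Rightarrow> 'l \<Rightarrow> (vertex, 'l) lgraph" where
  "model_graph a b = \<lparr>verts = model_verts, arrows = model_arrows a b\<rparr>"

lemma model_arrows_verts:
  "(x, s, y) \<in> model_arrows a b \<Longrightarrow> x \<in> model_verts \<and> y \<in> model_verts"
  by (erule model_arrows.cases) (auto simp: model_verts_def)


section \<open>F is a group acting on the dyadic rationals\<close>

lemma in_dyadics_iff: "x \<in> dyadics \<longleftrightarrow> (\<exists>m k. x = of_nat m / 2 ^ k)"
  unfolding dyadics_def by auto

lemma dyadics_0 [simp]: "(0::real) \<in> dyadics"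
  using real_in_dyadics[of 0] by simp

lemma dyadics_divide_2: "real n / 2 ^ k \<in> dyadics"
  unfolding in_dyadics_iff by blast

lemma dyadics_mult:
  fixes x y :: real
  assumes "x \<in> dyadics" "y \<in> dyadics"
  shows "x * y \<in> dyadics"
proof -
  obtain m k m' k' where "x = real m / 2 ^ k" "y = real m' / 2 ^ k'"
    using assms by (auto simp: in_dyadics_iff)
  then have "x * y = real (m * m') / 2 ^ (k + k')" by (simp add: power_add)
  then show ?thesis unfolding in_dyadics_iff by blast
qed

lemma dyadics_add_diff:
  fixes x y :: real
  assumes "x \<in> dyadics" "y \<in> dyadics"
  shows "x + y \<in> dyadics" and "y \<le> x \<Longrightarrow> x - y \<in> dyadics"
proof -
  obtain m k m' k' where mk: "x = real m / 2 ^ k" "y = real m' / 2 ^ k'"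
    using assms by (auto simp: in_dyadics_iff)
  have x: "x = real (m * 2 ^ k') / 2 ^ (k + k')" and y: "y = real (m' * 2 ^ k) / 2 ^ (k + k')"
    by (simp_all add: mk power_add)
  have "x + y = real (m * 2 ^ k' + m' * 2 ^ k) / 2 ^ (k + k')"
    unfolding x y by (simp add: add_divide_distrib)
  then show "x + y \<in> dyadics" unfolding in_dyadics_iff by blast
  assume "y \<le> x"
  then have "real (m' * 2 ^ k) \<le> real (m * 2 ^ k')"
    unfolding x y by (simp add: divide_le_cancel)
  then have "m' * 2 ^ k \<le> m * 2 ^ k'" by (simp only: of_nat_le_iff)
  then have "x - y = real (m * 2 ^ k' - m' * 2 ^ k) / 2 ^ (k + k')"
    unfolding x y by (simp only: of_nat_diff diff_divide_distrib)
  then show "x - y \<in> dyadics" unfolding in_dyadics_iff by blast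
qed

lemma dyadics_powi: "(2::real) powi k \<in> dyadics"
proof (cases "k \<ge> 0")
  case True
  then show ?thesis using real_in_dyadics[of "2 ^ nat k"] by (simp add: power_int_def)
next
  case False
  then show ?thesis using dyadics_divide_2[of 1 "nat (- k)"]
    by (simp add: power_int_def power_inverse inverse_eq_divide power_divide)
qed

lemma thompson_mapI:
  assumes "f \<in> extensional {0..1}" "homeomorphism {0..1} {0..1} f g" "strict_mono_on {0..1} f"
    and A: "finite A" "A \<subseteq> dyadics"
    and aff: "\<And>a b. \<lbrakk>0 \<le> a; a < b; b \<le> 1; {a<..<b} \<inter> A = {}\<rbrakk> \<Longrightarrow>
            \<exists>(k::int) c. \<forall>x\<in>{a..b}. f x = 2 powi k * x + c"
  shows "thompson_map f"
proof -
  have "\<exists>k::int. (f has_real_derivative 2 powi k) (at x within {0..1})" if x: "x \<in> {0..1} - A" for x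
  proof -
    have "open (- A)" using A by (simp add: finite_imp_closed open_Compl)
    then obtain e where e: "e > 0" "ball x e \<subseteq> - A"
      using x by (metis ComplI DiffD2 open_contains_ball)
    define a b where "a = max 0 (x - e)" and "b = min 1 (x + e)"
    have ab: "0 \<le> a" "a < b" "b \<le> 1" "a \<le> x" "x \<le> b"
      using x e by (auto simp: a_def b_def)
    have "{a<..<b} \<subseteq> ball x e" by (auto simp: a_def b_def dist_real_def)
    then have "{a<..<b} \<inter> A = {}" using e by blast
    from aff[OF ab(1-3) this] obtain k :: int and c where
      k: "\<forall>y\<in>{a..b}. f y = 2 powi k * y + c" by blast
    have "((\<lambda>y. 2 powi k * y + c) has_real_derivative 2 powi k) (at x within {0..1})"
      by (auto intro!: derivative_eq_intros)
    then have "(f has_real_derivative 2 powi k) (at x within {0..1})"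
    proof (rule has_field_derivative_transform_within[OF _ e(1)])
      fix y assume "y \<in> {0..1}" "dist y x < e"
      then have "y \<in> {a..b}" by (auto simp: a_def b_def dist_real_def)
      then show "2 powi k * y + c = f y" using k by simp
    qed (use x in auto)
    then show ?thesis by blast
  qed
  moreover have "\<exists>m c. \<forall>x\<in>{a..b}. f x = m * x + c"
    if "0 \<le> a \<and> a < b \<and> b \<le> 1 \<and> {a<..<b} \<inter> A = {}" for a b
    using aff[of a b] that by blast
  ultimately show ?thesis unfolding thompson_map_def using assms(1-5) by blast
qed

lemma thompson_mapE:
  assumes "thompson_map f"
  obtains g A where "f \<in> extensional {0..1}" "homeomorphism {0..1} {0..1} f g"
    "strict_mono_on {0..1} f" "finite A" "A \<subseteq> dyadics"
    "\<And>a b. \<lbrakk>0 \<le> a; a < b; b \<le> 1; {a<..<b} \<inter> A = {}\<rbrakk> \<Longrightarrow>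
       \<exists>(k::int) c. \<forall>x\<in>{a..b}. f x = 2 powi k * x + c"
proof -
  obtain g A where *: "f \<in> extensional {0..1}" "homeomorphism {0..1} {0..1} f g"
    "strict_mono_on {0..1} f" "finite A" "A \<subseteq> dyadics"
    and aff: "\<And>a b. \<lbrakk>0 \<le> a; a < b; b \<le> 1; {a<..<b} \<inter> A = {}\<rbrakk> \<Longrightarrow>
           \<exists>m c. \<forall>x\<in>{a..b}. f x = m * x + c"
    and der: "\<And>x. x \<in> {0..1} - A \<Longrightarrow>
           \<exists>k::int. (f has_real_derivative 2 powi k) (at x within {0..1})"
    using assms unfolding thompson_map_def by (elim conjE exE) metis
  have "\<exists>(k::int) c. \<forall>x\<in>{a..b}. f x = 2 powi k * x + c"
    if ab: "0 \<le> a" "a < b" "b \<le> 1" "{a<..<b} \<inter> A = {}" for a b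
  proof -
    obtain m c where mc: "\<forall>x\<in>{a..b}. f x = m * x + c" using aff[OF ab] by blast
    define x where "x = (a + b) / 2"
    have x: "x \<in> {a<..<b}" using ab by (auto simp: x_def)
    then have "x \<in> {0..1} - A" using ab by auto
    then obtain k :: int where "(f has_real_derivative 2 powi k) (at x within {0..1})"
      using der by blast
    then have 1: "(f has_real_derivative 2 powi k) (at x)"
      using x ab by (subst (asm) at_within_interior) auto
    have "((\<lambda>x. m * x + c) has_real_derivative m) (at x)"
      by (auto intro!: derivative_eq_intros)
    then have "(f has_real_derivative m) (at x)"
      by (rule has_field_derivative_transform_within_open[of _ _ _ "{a<..<b}"]) (use x mc in auto)
    with 1 have "m = 2 powi k" by (rule DERIV_unique[rotated])
    then show ?thesis using mc by blast
  qed
  then show ?thesis using that[OF *] by blast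
qed

lemma strict_mono_on_less_iff:
  fixes f :: "real \<Rightarrow> real"
  assumes "strict_mono_on S f" "x \<in> S" "y \<in> S"
  shows "f x < f y \<longleftrightarrow> x < y"
  using assms by (metis linorder_neqE_linordered_idom not_less_iff_gr_or_eq strict_mono_onD)

lemma strict_mono_01_endpoints:
  fixes f :: "real \<Rightarrow> real"
  assumes "strict_mono_on {0..1} f" "f ` {0..1} = {0..1}"
  shows "f 0 = 0" "f 1 = 1"
proof -
  have "0 \<in> f ` {0..1}" "1 \<in> f ` {0..1}" by (simp_all add: assms(2))
  then obtain x y where xy: "x \<in> {0..1}" "f x = 0" "y \<in> {0..1}" "f y = 1" by (metis imageE)
  have "f 0 \<in> {0..1}" "f 1 \<in> {0..1}"
    using imageI[of 0 "{0..1}" f] imageI[of 1 "{0..1}" f] unfolding assms(2) by simp_all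
  moreover have "\<not> f x < f 0" "\<not> f 1 < f y"
    using strict_mono_on_less_iff[OF assms(1), of x 0] strict_mono_on_less_iff[OF assms(1), of 1 y] xy
    by simp_all
  ultimately show "f 0 = 0" "f 1 = 1" using xy by simp_all
qed

lemma thompson_map_bij:
  assumes "thompson_map f"
  shows "bij_betw f {0..1} {0..1}" "f 0 = 0" "f 1 = 1" "strict_mono_on {0..1} f"
proof -
  obtain g where *: "homeomorphism {0..1} {0..1} f g" "strict_mono_on {0..1} f"
    using assms unfolding thompson_map_def by blast
  then have im: "f ` {0..1} = {0..1}" by (simp add: homeomorphism_def)
  show "strict_mono_on {0..1} f" by fact
  show "bij_betw f {0..1} {0..1}"
    unfolding bij_betw_def using im strict_mono_on_imp_inj_on[OF *(2)] by blast
  show "f 0 = 0" "f 1 = 1" using strict_mono_01_endpoints[OF *(2) im] by auto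
qed

lemma thompson_map_dyadic_iff:
  assumes f: "thompson_map f" and d: "d \<in> {0..1}"
  shows "f d \<in> dyadics \<longleftrightarrow> d \<in> dyadics"
proof -
  obtain g A where A: "finite A" "A \<subseteq> dyadics"
    and aff: "\<And>a b. \<lbrakk>0 \<le> a; a < b; b \<le> 1; {a<..<b} \<inter> A = {}\<rbrakk> \<Longrightarrow>
       \<exists>(k::int) c. \<forall>x\<in>{a..b}. f x = 2 powi k * x + c"
    by (rule thompson_mapE[OF f]) blast
  have f0: "f 0 = 0" using thompson_map_bij[OF f] by simp
  show ?thesis using d
  proof (induction "card (A \<inter> {0<..<d})" arbitrary: d rule: less_induct)
    case less
    show ?case
    proof (cases "d = 0")
      case True
      then show ?thesis by (simp add: f0)
    next
      case False
      define e where "e = Max (insert 0 (A \<inter> {0<..<d}))"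
      have e_in: "e \<in> insert 0 (A \<inter> {0<..<d})"
        unfolding e_def using A by (intro Max_in) auto
      have e: "0 \<le> e" "e < d" "e \<in> dyadics" using e_in False less.prems A by auto
      have "x \<le> e" if "x \<in> A \<inter> {0<..<d}" for x
        unfolding e_def using A that by (intro Max_ge) auto
      then have "{e<..<d} \<inter> A = {}" using e by force
      then obtain k :: int and c where "\<forall>x\<in>{e..d}. f x = 2 powi k * x + c"
        using aff[of e d] e less.prems by auto
      then have fd: "f d - f e = 2 powi k * (d - e)" using e by (simp add: algebra_simps)
      have fe: "f e \<in> dyadics"
      proof (cases "e = 0")
        case False
        then have "A \<inter> {0<..<e} \<subset> A \<inter> {0<..<d}" using e_in by auto
        then have "card (A \<inter> {0<..<e}) < card (A \<inter> {0<..<d})"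
          using A by (intro psubset_card_mono) auto
        then show ?thesis using less.hyps[of e] e less.prems by auto
      qed (simp add: f0)
      have 1: "f d = f e + 2 powi k * (d - e)" using fd by simp
      have "2 powi (- k) * (f d - f e) = (2 powi (- k) * 2 powi k) * (d - e)"
        unfolding fd by simp
      then have 2: "d = e + 2 powi (- k) * (f d - f e)"
        by (simp add: power_int_minus)
      have "f e < f d"
        using strict_mono_onD[OF thompson_map_bij(4)[OF f], of e d] e less.prems by auto
      show ?thesis
      proof
        assume "f d \<in> dyadics"
        then have "2 powi (- k) * (f d - f e) \<in> dyadics"
          using fe \<open>f e < f d\<close> by (intro dyadics_mult dyadics_powi dyadics_add_diff(2)) auto
        then show "d \<in> dyadics" using dyadics_add_diff(1)[OF e(3)] 2 by metis
      next
        assume "d \<in> dyadics"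
        then have "2 powi k * (d - e) \<in> dyadics"
          using e by (intro dyadics_mult dyadics_powi dyadics_add_diff(2)) auto
        then show "f d \<in> dyadics" using dyadics_add_diff(1)[OF fe] 1 by metis
      qed
    qed
  qed
qed

lemma thompson_map_id: "thompson_map (\<lambda>x\<in>{0..1}. x)"
proof (rule thompson_mapI[where A = "{}" and g = "\<lambda>x. x"])
  show "homeomorphism {0..1} {0..1} (\<lambda>x\<in>{0..1::real}. x) (\<lambda>x. x)"
    by (rule homeomorphism_cong[OF homeomorphism_ident]) auto
  fix a b :: real assume "0 \<le> a" "b \<le> 1"
  then show "\<exists>(k::int) c. \<forall>x\<in>{a..b}. (\<lambda>x\<in>{0..1}. x) x = 2 powi k * x + c"
    by (intro exI[of _ 0]) auto
qed (auto simp: strict_mono_on_def)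

lemma thompson_map_compose:
  assumes f: "thompson_map f" and h: "thompson_map h"
  shows "thompson_map (compose {0..1} h f)"
proof -
  obtain f' A where F: "homeomorphism {0..1} {0..1} f f'" "strict_mono_on {0..1} f"
    "finite A" "A \<subseteq> dyadics"
    "\<And>a b. \<lbrakk>0 \<le> a; a < b; b \<le> 1; {a<..<b} \<inter> A = {}\<rbrakk> \<Longrightarrow>
       \<exists>(k::int) c. \<forall>x\<in>{a..b}. f x = 2 powi k * x + c"
    by (rule thompson_mapE[OF f]) blast
  obtain h' B where H: "homeomorphism {0..1} {0..1} h h'" "strict_mono_on {0..1} h"
    "finite B" "B \<subseteq> dyadics"
    "\<And>a b. \<lbrakk>0 \<le> a; a < b; b \<le> 1; {a<..<b} \<inter> B = {}\<rbrakk> \<Longrightarrow>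
       \<exists>(k::int) c. \<forall>x\<in>{a..b}. h x = 2 powi k * x + c"
    by (rule thompson_mapE[OF h]) blast
  have inj: "inj_on f {0..1}" and im: "f ` {0..1} = {0..1}"
    using thompson_map_bij[OF f] by (auto simp: bij_betw_def)
  have f_in: "x \<in> {0..1} \<Longrightarrow> f x \<in> {0..1}" for x using im by blast
  define C where "C = A \<union> {x \<in> {0..1}. f x \<in> B}"
  show ?thesis
  proof (rule thompson_mapI[where A = C])
    show "homeomorphism {0..1} {0..1} (compose {0..1} h f) (f' \<circ> h')"
      by (rule homeomorphism_cong[OF homeomorphism_compose[OF F(1) H(1)]]) (auto simp: compose_def)
    show "strict_mono_on {0..1} (compose {0..1} h f)"
    proof (rule strict_mono_onI)
      fix r s :: real assume "r \<in> {0..1}" "s \<in> {0..1}" "r < s"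
      then show "compose {0..1} h f r < compose {0..1} h f s"
        using strict_mono_onD[OF H(2) f_in f_in] strict_mono_onD[OF F(2)]
        by (simp add: compose_def)
    qed
    have "finite (f -` B \<inter> {0..1})" by (rule finite_vimage_IntI[OF H(3) inj])
    moreover have "{x \<in> {0..1}. f x \<in> B} = f -` B \<inter> {0..1}" by auto
    ultimately show "finite C" using F(3) by (simp add: C_def)
    show "C \<subseteq> dyadics"
      using F(4) H(4) thompson_map_dyadic_iff[OF f] by (auto simp: C_def)
    fix a b :: real assume ab: "0 \<le> a" "a < b" "b \<le> 1" "{a<..<b} \<inter> C = {}"
    have less: "f x < f y \<longleftrightarrow> x < y" if "x \<in> {0..1}" "y \<in> {0..1}" for x y
      using strict_mono_on_less_iff[OF F(2) that] .
    have "{a<..<b} \<inter> A = {}" using ab(4) by (auto simp: C_def)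
    then obtain k :: int and c where k: "\<forall>x\<in>{a..b}. f x = 2 powi k * x + c"
      using F(5) ab by blast
    have "{f a<..<f b} \<inter> B = {}"
    proof (rule ccontr)
      assume "{f a<..<f b} \<inter> B \<noteq> {}"
      then obtain y where y: "f a < y" "y < f b" "y \<in> B" by auto
      moreover have "f a \<in> {0..1}" "f b \<in> {0..1}" using f_in ab by auto
      ultimately have "y \<in> {0..1}" by auto
      then obtain x where "x \<in> {0..1}" "y = f x" using im by (metis imageE)
      then have "x \<in> {a<..<b} \<inter> C" using y less ab by (auto simp: C_def)
      then show False using ab by blast
    qed
    moreover have "0 \<le> f a" "f a < f b" "f b \<le> 1" using f_in[of a] f_in[of b] less[of a b] ab by auto
    ultimately obtain l :: int and d where l: "\<forall>x\<in>{f a..f b}. h x = 2 powi l * x + d"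
      using H(5) by blast
    have "compose {0..1} h f x = 2 powi (l + k) * x + (2 powi l * c + d)" if x: "x \<in> {a..b}" for x
    proof -
      have "\<not> f x < f a" "\<not> f b < f x" using less[of x a] less[of b x] x ab by auto
      then have "f x \<in> {f a..f b}" by simp
      then have "h (f x) = 2 powi l * (2 powi k * x + c) + d" using l k x by auto
      then show ?thesis using x ab by (simp add: compose_def power_int_add algebra_simps)
    qed
    then show "\<exists>(k::int) c. \<forall>x\<in>{a..b}. compose {0..1} h f x = 2 powi k * x + c" by blast
  qed (simp add: compose_extensional)
qed

lemma thompson_map_inverse:
  assumes f: "thompson_map f"
  obtains h where "thompson_map h" "\<And>x. x \<in> {0..1} \<Longrightarrow> h (f x) = x"
proof -
  obtain f' A where F: "homeomorphism {0..1} {0..1} f f'" "strict_mono_on {0..1} f"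
    "finite A" "A \<subseteq> dyadics"
    "\<And>a b. \<lbrakk>0 \<le> a; a < b; b \<le> 1; {a<..<b} \<inter> A = {}\<rbrakk> \<Longrightarrow>
       \<exists>(k::int) c. \<forall>x\<in>{a..b}. f x = 2 powi k * x + c"
    by (rule thompson_mapE[OF f]) blast
  define h where "h = restrict f' {0..1}"
  have im: "f ` {0..1} = {0..1}" using F(1) by (simp add: homeomorphism_def)
  have hf: "h (f x) = x" if "x \<in> {0..1}" for x
    using F(1) that im by (auto simp: h_def homeomorphism_def)
  have fh: "f (h y) = y" "h y \<in> {0..1}" if "y \<in> {0..1}" for y
    using F(1) that by (auto simp: h_def homeomorphism_def)
  have less: "f x < f y \<longleftrightarrow> x < y" if "x \<in> {0..1}" "y \<in> {0..1}" for x y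
    using strict_mono_on_less_iff[OF F(2) that] .
  have hless: "h x < h y \<longleftrightarrow> x < y" if "x \<in> {0..1}" "y \<in> {0..1}" for x y
    using less[of "h x" "h y"] fh that by simp
  have "thompson_map h"
  proof (rule thompson_mapI[where A = "f ` (A \<inter> {0..1})"])
    show "h \<in> extensional {0..1}" by (simp add: h_def)
    show "homeomorphism {0..1} {0..1} h f"
      by (rule homeomorphism_cong[OF homeomorphism_symD[OF F(1)]]) (auto simp: h_def)
    show "strict_mono_on {0..1} h" using hless by (intro strict_mono_onI) auto
    show "finite (f ` (A \<inter> {0..1}))" using F by simp
    show "f ` (A \<inter> {0..1}) \<subseteq> dyadics" using F(4) thompson_map_dyadic_iff[OF f] by auto
    fix a b :: real assume ab: "0 \<le> a" "a < b" "b \<le> 1" "{a<..<b} \<inter> f ` (A \<inter> {0..1}) = {}"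
    have in01: "h a \<in> {0..1}" "h b \<in> {0..1}" using fh ab by auto
    have "{h a<..<h b} \<inter> A = {}"
    proof (rule ccontr)
      assume "{h a<..<h b} \<inter> A \<noteq> {}"
      then obtain x where x: "h a < x" "x < h b" "x \<in> A" by auto
      then have x01: "x \<in> {0..1}" using in01 by auto
      then have "f x \<in> {a<..<b}"
        using less[of "h a" x] less[of x "h b"] in01 x fh(1)[of a] fh(1)[of b] ab by simp
      then show False using ab x x01 by blast
    qed
    moreover have "0 \<le> h a" "h a < h b" "h b \<le> 1" using in01 hless[of a b] ab by auto
    ultimately obtain k :: int and c where k: "\<forall>x\<in>{h a..h b}. f x = 2 powi k * x + c"
      using F(5) by blast
    have "h y = 2 powi (- k) * y + (- (2 powi (- k) * c))" if y: "y \<in> {a..b}" for y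
    proof -
      have "\<not> h y < h a" "\<not> h b < h y" using hless[of y a] hless[of b y] y ab by auto
      then have "h y \<in> {h a..h b}" by simp
      then have "y = 2 powi k * h y + c" using k fh[of y] y ab by auto
      then show ?thesis by (simp add: power_int_minus field_simps)
    qed
    then show "\<exists>(k::int) c. \<forall>x\<in>{a..b}. h x = 2 powi k * x + c" by blast
  qed
  then show ?thesis using hf that by blast
qed

lemma group_thompson_F: "group thompson_F"
proof (rule groupI)
  fix f g h assume *: "f \<in> carrier thompson_F" "g \<in> carrier thompson_F" "h \<in> carrier thompson_F"
  then have "f x \<in> {0..1}" if "x \<in> {0..1}" for x
    using thompson_map_bij(1)[of f] that by (auto simp: thompson_F_def bij_betw_def)
  then show "f \<otimes>\<^bsub>thompson_F\<^esub> g \<otimes>\<^bsub>thompson_F\<^esub> h = f \<otimes>\<^bsub>thompson_F\<^esub> (g \<otimes>\<^bsub>thompson_F\<^esub> h)"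
    by (auto simp: thompson_F_def compose_def fun_eq_iff)
next
  fix f assume f: "f \<in> carrier thompson_F"
  then have "f \<in> extensional {0..1}" by (auto simp: thompson_F_def thompson_map_def)
  then show "\<one>\<^bsub>thompson_F\<^esub> \<otimes>\<^bsub>thompson_F\<^esub> f = f"
    by (auto simp: thompson_F_def compose_def fun_eq_iff extensional_def)
  have f': "thompson_map f" using f by (simp add: thompson_F_def)
  obtain h where h: "thompson_map h" "\<And>x. x \<in> {0..1} \<Longrightarrow> h (f x) = x"
    using thompson_map_inverse[OF f'] by metis
  obtain g where g: "thompson_map g" "\<And>x. x \<in> {0..1} \<Longrightarrow> g (h x) = x"
    using thompson_map_inverse[OF h(1)] by metis
  have "f (h x) = x" if x: "x \<in> {0..1}" for x
  proof -
    obtain y where "y \<in> {0..1}" "x = f y"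
      using thompson_map_bij(1)[OF f'] x by (metis bij_betw_def imageE)
    then show ?thesis using h by simp
  qed
  then show "\<exists>h\<in>carrier thompson_F. h \<otimes>\<^bsub>thompson_F\<^esub> f = \<one>\<^bsub>thompson_F\<^esub>"
    using h(1) by (intro bexI[of _ h]) (auto simp: thompson_F_def compose_def fun_eq_iff)
qed (auto simp: thompson_F_def thompson_map_compose thompson_map_id)

lemma thompson_F_acts: "right_group_action thompson_F dyadics01 (\<lambda>f d. f d)"
proof (intro right_group_action.intro right_group_action_axioms.intro)
  show "group thompson_F" by (rule group_thompson_F)
  fix f x assume f: "f \<in> carrier thompson_F" and x: "x \<in> dyadics01"
  have f': "thompson_map f" using f by (simp add: thompson_F_def)
  note sm = strict_mono_onD[OF thompson_map_bij(4)[OF f']]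
  have x': "0 < x" "x < 1" "x \<in> dyadics" using x by (auto simp: dyadics01_def)
  have "f x \<in> dyadics" using thompson_map_dyadic_iff[OF f', of x] x' by simp
  moreover have "f 0 < f x" "f x < f 1" using x' sm[of 0 x] sm[of x 1] by simp_all
  ultimately show "f x \<in> dyadics01"
    by (simp add: dyadics01_def thompson_map_bij[OF f'])
qed (auto simp: thompson_F_def dyadics01_def compose_def)

lemma thompson_x0_in_F: "thompson_x0 \<in> carrier thompson_F"
proof -
  have sm: "strict_mono_on {0..1} thompson_x0"
    by (rule strict_mono_onI) (auto simp: thompson_x0_def)
  have "continuous_on {0..1} (\<lambda>t::real. max (t / 2) (max (t - 1/4) (2 * t - 1)))"
    by (intro continuous_intros) auto
  then have cont: "continuous_on {0..1} thompson_x0"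
    by (rule continuous_on_eq) (auto simp: thompson_x0_def max_def)
  have im: "thompson_x0 ` {0..1} = {0..1}"
  proof (intro antisym subsetI)
    fix y :: real assume y: "y \<in> {0..1}"
    then have "\<exists>x\<ge>0. x \<le> 1 \<and> thompson_x0 x = y"
      using IVT'[of thompson_x0 0 y 1] cont by (auto simp: thompson_x0_def)
    then show "y \<in> thompson_x0 ` {0..1}" by force
  qed (auto simp: thompson_x0_def split: if_splits)
  obtain g where g: "homeomorphism {0..1} {0..1} thompson_x0 g"
    using homeomorphism_compact[OF _ cont im strict_mono_on_imp_inj_on[OF sm]] by auto
  have "thompson_map thompson_x0"
  proof (rule thompson_mapI[OF _ g sm, where A = "{1/2, 3/4}"])
    show "{1/2, 3/4 :: real} \<subseteq> dyadics"
      using dyadics_divide_2[of 1 1] dyadics_divide_2[of 3 2]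
      by simp
    fix a b :: real assume ab: "0 \<le> a" "a < b" "b \<le> 1" "{a<..<b} \<inter> {1/2, 3/4} = {}"
    then consider "b \<le> 1/2" | "1/2 \<le> a" "b \<le> 3/4" | "3/4 \<le> a" by force
    then show "\<exists>(k::int) c. \<forall>x\<in>{a..b}. thompson_x0 x = 2 powi k * x + c"
    proof cases
      case 1
      then show ?thesis using ab
        by (intro exI[of _ "-1"] exI[of _ 0]) (auto simp: thompson_x0_def power_int_minus)
    next
      case 2
      then show ?thesis using ab
        by (intro exI[of _ 0] exI[of _ "-1/4"]) (auto simp: thompson_x0_def)
    next
      case 3
      then show ?thesis using ab
        by (intro exI[of _ 1] exI[of _ "-1"]) (auto simp: thompson_x0_def)
    qed
  qed (auto simp: thompson_x0_def)
  then show ?thesis by (simp add: thompson_F_def)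
qed

lemma thompson_x1_in_F: "thompson_x1 \<in> carrier thompson_F"
proof -
  have sm: "strict_mono_on {0..1} thompson_x1"
    by (rule strict_mono_onI) (auto simp: thompson_x1_def)
  have "continuous_on {0..1} (\<lambda>t::real. min t (max (t / 2 + 1/4) (max (t - 1/8) (2 * t - 1))))"
    by (intro continuous_intros) auto
  then have cont: "continuous_on {0..1} thompson_x1"
    by (rule continuous_on_eq) (auto simp: thompson_x1_def max_def min_def)
  have im: "thompson_x1 ` {0..1} = {0..1}"
  proof (intro antisym subsetI)
    fix y :: real assume y: "y \<in> {0..1}"
    then have "\<exists>x\<ge>0. x \<le> 1 \<and> thompson_x1 x = y"
      using IVT'[of thompson_x1 0 y 1] cont by (auto simp: thompson_x1_def)
    then show "y \<in> thompson_x1 ` {0..1}" by force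
  qed (auto simp: thompson_x1_def split: if_splits)
  obtain g where g: "homeomorphism {0..1} {0..1} thompson_x1 g"
    using homeomorphism_compact[OF _ cont im strict_mono_on_imp_inj_on[OF sm]] by auto
  have "thompson_map thompson_x1"
  proof (rule thompson_mapI[OF _ g sm, where A = "{1/2, 3/4, 7/8}"])
    show "{1/2, 3/4, 7/8 :: real} \<subseteq> dyadics"
      using dyadics_divide_2[of 1 1] dyadics_divide_2[of 3 2]
        dyadics_divide_2[of 7 3]
      by simp
    fix a b :: real assume ab: "0 \<le> a" "a < b" "b \<le> 1" "{a<..<b} \<inter> {1/2, 3/4, 7/8} = {}"
    then consider "b \<le> 1/2" | "1/2 \<le> a" "b \<le> 3/4" | "3/4 \<le> a" "b \<le> 7/8" | "7/8 \<le> a" by force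
    then show "\<exists>(k::int) c. \<forall>x\<in>{a..b}. thompson_x1 x = 2 powi k * x + c"
    proof cases
      case 1
      then show ?thesis using ab
        by (intro exI[of _ 0] exI[of _ 0]) (auto simp: thompson_x1_def)
    next
      case 2
      then show ?thesis using ab
        by (intro exI[of _ "-1"] exI[of _ "1/4"]) (auto simp: thompson_x1_def power_int_minus)
    next
      case 3
      then show ?thesis using ab
        by (intro exI[of _ 0] exI[of _ "-1/8"]) (auto simp: thompson_x1_def)
    next
      case 4
      then show ?thesis using ab
        by (intro exI[of _ 1] exI[of _ "-1"]) (auto simp: thompson_x1_def)
    qed
  qed (auto simp: thompson_x1_def)
  then show ?thesis by (simp add: thompson_F_def)
qed

end

theory Submission
  imports Defs
begin

text \<open>
  The isomorphism is written down from the side of the model graph.  Reading a word from left to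
  right, starting from \<open>1/2\<close> and applying \<open>h \<mapsto> h/2\<close> for \<open>L\<close> and \<open>h \<mapsto> (1 + h)/2\<close> for \<open>R\<close>, puts
  the words in bijection with the dyadic rationals in \<open>(0,1)\<close>.  The gray vertex of a word with value
  \<open>h\<close> sits at \<open>1/2 + h/4\<close>, so the gray vertices are the dyadics in \<open>(1/2, 3/4)\<close>; these together with
  \<open>1/2\<close> are a fundamental domain for \<open>x\<^sub>0\<close>, and all other vertices are obtained as \<open>x\<^sub>0\<close>-translates.
  Every model vertex has an outgoing arrow for each label, so once the vertex map is known to be
  injective and to send arrows to arrows, it reflects arrows as well.
\<close>

section \<open>Binary words and dyadic rationals\<close>

definition word_value :: "letter list \<Rightarrow> real" where
  "word_value w = foldl (\<lambda>h l. case l of L \<Rightarrow> h / 2 | R \<Rightarrow> (1 + h) / 2) (1/2) w"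

lemma word_value_simps [simp]:
  "word_value [] = 1/2"
  "word_value (w @ [L]) = word_value w / 2"
  "word_value (w @ [R]) = (1 + word_value w) / 2"
  by (simp_all add: word_value_def)

lemma word_value_bounds: "0 < word_value w" "word_value w < 1"
proof -
  have "0 < word_value w \<and> word_value w < 1"
  proof (induction w rule: rev_induct)
    case (snoc l w)
    then show ?case by (cases l) auto
  qed simp
  then show "0 < word_value w" "word_value w < 1" by auto
qed

text \<open>Both letter maps are injective, and they send \<open>(0,1)\<close> to opposite sides of
  \<open>1/2\<close>, the value of the empty word. So a value determines the last letter, and
  induction peels it off.\<close>

lemma word_value_eq_iff [simp]: "word_value v = word_value w \<longleftrightarrow> v = w"
proof
  show "word_value v = word_value w \<Longrightarrow> v = w"
  proof (induction v arbitrary: w rule: rev_induct)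
    case Nil
    show ?case
    proof (cases w rule: rev_cases)
      case (snoc w' l)
      then show ?thesis using Nil word_value_bounds[of w'] by (cases l) auto
    qed simp
  next
    case (snoc l v)
    note v = word_value_bounds[of v]
    show ?case
    proof (cases w rule: rev_cases)
      case Nil
      then show ?thesis using snoc.prems v by (cases l) auto
    next
      case w: (snoc w' l')
      show ?thesis
        using snoc.prems snoc.IH[of w'] v word_value_bounds[of w'] unfolding w
        by (cases l; cases l') auto
    qed
  qed
qed simp

lemma half_dyadics: "(x::real) \<in> dyadics \<Longrightarrow> x / 2 \<in> dyadics"
  using dyadics_mult[OF _ dyadics_divide_2[of 1 1], of x] by simp

lemma one_dyadics: "(1::real) \<in> dyadics"
  using real_in_dyadics[of 1] by simp

lemma divide_power2_dyadics: "(x::real) \<in> dyadics \<Longrightarrow> x / 2 ^ k \<in> dyadics"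
  using dyadics_mult[OF _ dyadics_divide_2[of 1 k], of x] by simp

lemma mult_power2_dyadics: "(x::real) \<in> dyadics \<Longrightarrow> x * 2 ^ k \<in> dyadics"
  using dyadics_mult[OF _ real_in_dyadics[of "2 ^ k"], of x] by simp

lemma word_value_dyadic: "word_value w \<in> dyadics"
proof (induction w rule: rev_induct)
  case Nil
  show ?case using half_dyadics[OF one_dyadics] by simp
next
  case (snoc l w)
  then show ?case
    by (cases l) (auto intro!: half_dyadics dyadics_add_diff(1) one_dyadics)
qed

text \<open>Induction on the exponent of the denominator: doubling \<open>h\<close>, and subtracting
  \<open>1\<close> if \<open>h > 1/2\<close>, undoes the last letter and lowers the exponent by
  one.\<close>

lemma word_value_surj:
  assumes "h \<in> dyadics01"
  obtains w where "h = word_value w"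
proof -
  obtain m n where "h = real m / 2 ^ n" and "0 < h" "h < 1"
    using assms by (auto simp: dyadics01_def in_dyadics_iff)
  then have "\<exists>w. h = word_value w"
  proof (induction n arbitrary: h m)
    \<comment> \<open>No integer lies strictly between \<open>0\<close> and
      \<open>1\<close>.\<close>
    case 0
    then show ?case by simp
  next
    case (Suc n)
    have m: "2 * h = real m / 2 ^ n" using Suc.prems by simp
    consider "h = 1/2" | "h < 1/2" | "h > 1/2" by linarith
    then show ?case
    proof cases
      case 1
      then show ?thesis by (intro exI[of _ "[]"]) simp
    next
      case 2
      then obtain w where "2 * h = word_value w" using Suc.IH[OF m] Suc.prems by auto
      then show ?thesis by (intro exI[of _ "w @ [L]"]) simp
    next
      case 3
      have "1 < real m / 2 ^ n" using m 3 by linarith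
      then have "real (2 ^ n) < real m" by (simp add: field_simps)
      then have "2 ^ n \<le> m" by simp
      then have "2 * h - 1 = real (m - 2 ^ n) / 2 ^ n"
        using m by (simp add: of_nat_diff field_simps)
      then obtain w where "2 * h - 1 = word_value w"
        using Suc.IH[of "2 * h - 1" "m - 2 ^ n"] 3 Suc.prems by auto
      then show ?thesis by (intro exI[of _ "w @ [R]"]) simp
    qed
  qed
  then show ?thesis using that by blast
qed

section \<open>Positions of the vertices and binary scaling\<close>

text \<open>
  Up to \<open>1/2\<close> the value is \<open>a / 2 ^ n\<close> with \<open>a \<in> [1,2)\<close>; above \<open>1/2\<close> it is \<open>1 - a / 2 ^ n\<close> with
  \<open>a \<in> (1,2]\<close>.  This normal form makes injectivity and surjectivity a matter of binary scaling.
\<close>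

fun vertex_value :: "vertex \<Rightarrow> real" where
  "vertex_value (P k) = (if k \<ge> 0 then 1 / 2 ^ (nat k + 1) else 1 - 2 / 2 ^ (nat (- k) + 2))"
| "vertex_value (Gray w) = 1 - (2 - word_value w) / 2 ^ 2"
| "vertex_value (Black w k) = (1 + word_value w) / 2 ^ (k + 1)"
| "vertex_value (White w k) = 1 - (2 - word_value w) / 2 ^ (k + 2)"

text \<open>The size bounds put \<open>a / b\<close> strictly between \<open>1/2\<close> and
  \<open>2\<close>, where \<open>1\<close> is the only power of two. They hold for two numbers in
  \<open>[1,2)\<close> as well as for two in \<open>(1,2]\<close>.\<close>

lemma divide_power2_unique:
  fixes a b :: real
  assumes "a / 2 ^ k = b / 2 ^ l" "0 < a" "0 < b" "a < 2 * b" "b < 2 * a"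
  shows "k = l \<and> a = b"
  using assms(1)
proof (induction k l rule: diff_induct)
  case (1 k)
  show ?case
  proof (cases k)
    case (Suc n)
    have "b * 1 \<le> b * 2 ^ n" using assms(3) by (intro mult_left_mono) auto
    then show ?thesis using 1 Suc assms(4) by (simp add: field_simps)
  qed (use 1 in simp)
next
  case (2 l)
  have "a * 1 \<le> a * 2 ^ l" using assms(2) by (intro mult_left_mono) auto
  then show ?case using 2 assms(5) by (simp add: field_simps)
qed simp

text \<open>\<open>Suc k\<close> is the least exponent lifting \<open>d\<close> to at least
  \<open>1\<close>; it is positive since \<open>d < 1\<close>, and minimality gives the upper
  bound.\<close>

lemma binary_scaling:
  fixes d :: real
  assumes "0 < d" "d < 1"
  obtains k where "1 \<le> d * 2 ^ Suc k" "d * 2 ^ Suc k < 2"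
proof -
  obtain n where "1 / d < 2 ^ n" using real_arch_pow[of 2 "1 / d"] by auto
  then have n: "1 \<le> d * 2 ^ n" using assms by (simp add: field_simps)
  define m where "m = (LEAST n. 1 \<le> d * 2 ^ n)"
  have m: "1 \<le> d * 2 ^ m" unfolding m_def using n by (rule LeastI)
  then obtain k where k: "m = Suc k" using assms by (cases m) auto
  have "\<not> 1 \<le> d * 2 ^ k" using not_less_Least[of k "\<lambda>n. 1 \<le> d * 2 ^ n"] k by (simp add: m_def)
  then show ?thesis using that[of k] m k by simp
qed

text \<open>Serves the points above \<open>1/2\<close>: a scaled value of exactly \<open>1\<close>
  is doubled once more to reach the closed end \<open>2\<close>.\<close>

lemma binary_scaling':
  fixes d :: real
  assumes "0 < d" "d < 1"
  obtains k where "1 < d * 2 ^ Suc k" "d * 2 ^ Suc k \<le> 2"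
proof -
  obtain k where k: "1 \<le> d * 2 ^ Suc k" "d * 2 ^ Suc k < 2" using binary_scaling[OF assms] .
  show ?thesis
  proof (cases "d * 2 ^ Suc k = 1")
    case True
    then show ?thesis using that[of "Suc k"] by simp
  qed (use k that[of k] in simp)
qed

section \<open>Normal forms and injectivity\<close>

lemma model_verts_cases:
  assumes "v \<in> model_verts"
  obtains (P_nonneg) n where "v = P (int n)" | (P_neg) n where "v = P (- int (Suc n))"
  | (Gray) w where "v = Gray w" | (Black) w n where "v = Black w (Suc n)"
  | (White) w n where "v = White w (Suc n)"
proof (cases v)
  case (P k)
  then show ?thesis by (cases k rule: int_cases) (use that in auto)
next
  case (Black w k)
  then show ?thesis using assms that by (cases k) (auto simp: model_verts_def)
next
  case (White w k)
  then show ?thesis using assms that by (cases k) (auto simp: model_verts_def)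
qed (use that in auto)

lemma vertex_value_P_neg: "vertex_value (P (- int (Suc n))) = 1 - 1 / 2 ^ (n + 2)"
proof -
  have "nat (- (- int (Suc n))) = Suc n" by (simp only: minus_minus nat_int)
  then show ?thesis by (simp del: of_nat_Suc)
qed

text \<open>Naming the power keeps the simplifier from discarding the bound \<open>1 \<le> 2 ^ n\<close> as trivial.\<close>

lemma power2_ge_one:
  obtains p :: real where "2 ^ n = p" "1 \<le> p"
  by (rule that[OF refl]) simp

lemma inv_word_value [simp]: "inv_into UNIV word_value (word_value w) = w"
  by (rule inv_f_f) (simp add: inj_def)

text \<open>On each side of \<open>1/2\<close> the vertex, its kind included, is a function of
  \<open>a\<close> and \<open>n\<close>. Injectivity then needs only uniqueness of \<open>a\<close>
  and \<open>n\<close>, not a comparison of all pairs of kinds.\<close>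

lemma vertex_value_normal_form:
  assumes "v \<in> model_verts"
  shows "(\<exists>a n. vertex_value v = a / 2 ^ n \<and> vertex_value v \<le> 1/2 \<and> 1 \<le> a \<and> a < 2 \<and>
            v = (if a = 1 then P (int n - 1) else Black (inv_into UNIV word_value (a - 1)) (n - 1))) \<or>
         (\<exists>a n. 1 - vertex_value v = a / 2 ^ n \<and> 1/2 < vertex_value v \<and> 1 < a \<and> a \<le> 2 \<and>
            v = (if a = 2 then P (2 - int n) else if n = 2 then Gray (inv_into UNIV word_value (2 - a))
                 else White (inv_into UNIV word_value (2 - a)) (n - 2)))"
    (is "?lower \<or> ?upper")
proof -
  from assms show ?thesis
  proof (cases v rule: model_verts_cases)
    case (P_nonneg n)
    obtain p :: real where p: "2 ^ n = p" "1 \<le> p" by (rule power2_ge_one)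
    have ?lower
      using P_nonneg p(2) by (intro exI[of _ "1::real"] exI[of _ "n + 1"]) (simp add: p(1) field_simps)
    then show ?thesis ..
  next
    case (P_neg n)
    have "vertex_value v = 1 - 1 / 2 ^ (n + 2)" using P_neg vertex_value_P_neg by simp
    \<comment> \<open>\<open>1 / 2 ^ (n + 2)\<close> is read as \<open>2 / 2 ^ (n + 3)\<close>,
      since \<open>a\<close> must lie in \<open>(1,2]\<close>.\<close>
    then have ?upper
      using P_neg one_less_power[of "2::real" "Suc n"]
      by (intro exI[of _ "2::real"] exI[of _ "n + 3"]) (auto simp: field_simps power_add)
    then show ?thesis ..
  next
    case (Gray w)
    have ?upper
      using Gray word_value_bounds[of w]
      by (intro exI[of _ "2 - word_value w"] exI[of _ 2]) (simp add: field_simps)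
    then show ?thesis ..
  next
    case (Black w n)
    obtain p :: real where p: "2 ^ n = p" "1 \<le> p" by (rule power2_ge_one)
    have ?lower
      using Black word_value_bounds[of w] p(2)
      by (intro exI[of _ "1 + word_value w"] exI[of _ "n + 2"]) (simp add: p(1) field_simps)
    then show ?thesis ..
  next
    case (White w n)
    obtain p :: real where p: "2 ^ n = p" "1 \<le> p" by (rule power2_ge_one)
    have ?upper
      using White word_value_bounds[of w] p(2)
      by (intro exI[of _ "2 - word_value w"] exI[of _ "n + 3"]) (simp add: p(1) power_add field_simps)
    then show ?thesis ..
  qed
qed

lemma inj_on_vertex_value: "inj_on vertex_value model_verts"
proof (rule inj_onI)
  fix v v' assume v: "v \<in> model_verts" "v' \<in> model_verts" and eq: "vertex_value v = vertex_value v'"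
  show "v = v'"
  proof (cases "vertex_value v \<le> 1/2")
    case True
    obtain a n where a: "vertex_value v = a / 2 ^ n" "1 \<le> a" "a < 2"
      "v = (if a = 1 then P (int n - 1) else Black (inv_into UNIV word_value (a - 1)) (n - 1))"
      using vertex_value_normal_form[OF v(1)] True by force
    obtain b m where b: "vertex_value v' = b / 2 ^ m" "1 \<le> b" "b < 2"
      "v' = (if b = 1 then P (int m - 1) else Black (inv_into UNIV word_value (b - 1)) (m - 1))"
      using vertex_value_normal_form[OF v(2)] True eq by force
    have "n = m \<and> a = b" by (rule divide_power2_unique) (use a b eq in auto)
    then show ?thesis using a b by simp
  next
    case False
    obtain a n where a: "1 - vertex_value v = a / 2 ^ n" "1 < a" "a \<le> 2"
      "v = (if a = 2 then P (2 - int n) else if n = 2 then Gray (inv_into UNIV word_value (2 - a))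
            else White (inv_into UNIV word_value (2 - a)) (n - 2))"
      using vertex_value_normal_form[OF v(1)] False by force
    obtain b m where b: "1 - vertex_value v' = b / 2 ^ m" "1 < b" "b \<le> 2"
      "v' = (if b = 2 then P (2 - int m) else if m = 2 then Gray (inv_into UNIV word_value (2 - b))
             else White (inv_into UNIV word_value (2 - b)) (m - 2))"
      using vertex_value_normal_form[OF v(2)] False eq by force
    have "n = m \<and> a = b" by (rule divide_power2_unique) (use a b eq in auto)
    then show ?thesis using a b by simp
  qed
qed

lemma vertex_value_in_dyadics01:
  assumes "v \<in> model_verts"
  shows "vertex_value v \<in> dyadics01"
proof -
  have two: "(2::real) \<in> dyadics" using real_in_dyadics[of 2] by simp
  have "1 - (2 - word_value w) / 2 ^ k \<in> dyadics" if "k \<ge> 1" for w k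
  proof -
    \<comment> \<open>\<open>dyadics\<close> holds only non-negative numbers, so closure under
      subtraction needs the subtrahend to be at most \<open>1\<close>.\<close>
    have "2 ^ 1 \<le> (2::real) ^ k" using that by (intro power_increasing) auto
    then show ?thesis using word_value_bounds[of w]
      by (intro dyadics_add_diff(2) one_dyadics divide_power2_dyadics two word_value_dyadic)
        (auto simp: field_simps)
  qed
  moreover have "1 - 2 / 2 ^ k \<in> (dyadics :: real set)" if "k \<ge> 1" for k
  proof -
    have "2 ^ 1 \<le> (2::real) ^ k" using that by (intro power_increasing) auto
    then show ?thesis
      by (intro dyadics_add_diff(2) one_dyadics divide_power2_dyadics two) (auto simp: field_simps)
  qed
  moreover have "1 / 2 ^ k \<in> (dyadics :: real set)" "(1 + word_value w) / 2 ^ k \<in> dyadics" for w k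
    by (intro divide_power2_dyadics dyadics_add_diff(1) one_dyadics word_value_dyadic)+
  ultimately have "vertex_value v \<in> dyadics"
    by (cases v) (simp_all only: vertex_value.simps split: if_split, auto simp del: power_Suc)
  moreover have "0 < vertex_value v \<and> vertex_value v < 1"
    using vertex_value_normal_form[OF assms]
  proof (elim disjE exE conjE)
    fix a :: real and n
    assume "vertex_value v = a / 2 ^ n" "1 \<le> a" "vertex_value v \<le> 1/2"
    moreover from this have "0 < a / 2 ^ n" by simp
    ultimately show ?thesis by linarith
  next
    fix a :: real and n
    assume "1 - vertex_value v = a / 2 ^ n" "1 < a" "1/2 < vertex_value v"
    moreover from this have "0 < a / 2 ^ n" by simp
    ultimately show ?thesis by linarith
  qed
  ultimately show ?thesis by (simp add: dyadics01_def)
qed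

section \<open>Surjectivity onto the dyadics\<close>

lemma vertex_value_surj:
  assumes d: "d \<in> dyadics01"
  shows "d \<in> vertex_value ` model_verts"
proof -
  have d': "0 < d" "d < 1" "d \<in> dyadics" using d by (auto simp: dyadics01_def)
  consider "d = 1/2" | "d < 1/2" | "d > 1/2" by linarith
  then show ?thesis
  proof cases
    case 1
    then show ?thesis by (intro image_eqI[of _ _ "P 0"]) (auto simp: model_verts_def)
  next
    case 2
    obtain k where k: "1 \<le> d * 2 ^ Suc k" "d * 2 ^ Suc k < 2" using binary_scaling[OF d'(1,2)] .
    \<comment> \<open>\<open>k = 0\<close> would give \<open>d \<ge> 1/2\<close>; black indices
      start at \<open>1\<close>.\<close>
    have "k \<noteq> 0" using 2 k by (cases k) auto
    show ?thesis
    proof (cases "d * 2 ^ Suc k = 1")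
      case True
      then have "d = vertex_value (P (int k))" by (simp add: field_simps)
      moreover have "P (int k) \<in> model_verts" by (simp add: model_verts_def)
      ultimately show ?thesis by (rule image_eqI)
    next
      case False
      have "d * 2 ^ Suc k - 1 \<in> dyadics01"
        unfolding dyadics01_def
        using False k dyadics_add_diff(2)[OF mult_power2_dyadics[OF d'(3)] one_dyadics k(1)] by simp
      then obtain w where "d * 2 ^ Suc k - 1 = word_value w" by (rule word_value_surj)
      then have "d = (1 + word_value w) / 2 ^ Suc k" by (simp add: field_simps)
      then show ?thesis using \<open>k \<noteq> 0\<close>
        by (intro image_eqI[of _ _ "Black w k"]) (auto simp: model_verts_def)
    qed
  next
    case 3
    have e: "0 < 1 - d" "1 - d < 1" "1 - d \<in> dyadics"
      using d' dyadics_add_diff(2)[OF one_dyadics] by auto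
    obtain j where j: "1 < (1 - d) * 2 ^ Suc j" "(1 - d) * 2 ^ Suc j \<le> 2"
      using binary_scaling'[OF e(1,2)] .
    \<comment> \<open>\<open>j = 0\<close> would give \<open>1 - d > 1/2\<close>. With
      \<open>j = Suc k\<close> and off the \<open>P\<close> vertices, \<open>k = 0\<close> is a gray
      vertex and \<open>k \<ge> 1\<close> a white one.\<close>
    have "j \<noteq> 0" using 3 j by (cases j) auto
    then obtain k where k: "j = Suc k" by (cases j) auto
    show ?thesis
    proof (cases "(1 - d) * 2 ^ Suc j = 2")
      case True
      then have 1: "d = 1 - 1 / 2 ^ Suc k" using k by (simp add: field_simps)
      then have "k \<noteq> 0" using 3 by (cases k) auto
      then have "d = vertex_value (P (- int k))" using 1 by simp
      moreover have "P (- int k) \<in> model_verts" by (simp add: model_verts_def)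
      ultimately show ?thesis by (rule image_eqI)
    next
      case False
      have "2 - (1 - d) * 2 ^ Suc j \<in> dyadics01"
        unfolding dyadics01_def
        using False j dyadics_add_diff(2)[OF real_in_dyadics[of 2] mult_power2_dyadics[OF e(3)], of "Suc j"]
        by simp
      then obtain w where "2 - (1 - d) * 2 ^ Suc j = word_value w" by (rule word_value_surj)
      then have "1 - d = (2 - word_value w) / 2 ^ Suc j" by (simp add: field_simps)
      then have w: "d = 1 - (2 - word_value w) / 2 ^ (k + 2)" by (simp add: k)
      show ?thesis
      proof (cases "k = 0")
        case True
        then show ?thesis using w
          by (intro image_eqI[of _ _ "Gray w"]) (auto simp: model_verts_def)
      next
        case False
        then show ?thesis using w
          by (intro image_eqI[of _ _ "White w k"]) (auto simp: model_verts_def)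
      qed
    qed
  qed
qed

section \<open>The generators on vertex positions\<close>

lemma thompson_x0_simps:
  "0 \<le> t \<Longrightarrow> t \<le> 1/2 \<Longrightarrow> thompson_x0 t = t / 2"
  "1/2 \<le> t \<Longrightarrow> t \<le> 3/4 \<Longrightarrow> thompson_x0 t = t - 1/4"
  "3/4 \<le> t \<Longrightarrow> t \<le> 1 \<Longrightarrow> thompson_x0 t = 2 * t - 1"
  by (auto simp: thompson_x0_def)

text \<open>As for \<open>thompson_x0\<close>, the ranges overlap at the breakpoints, where the
  formulas agree, so boundary vertices need no strict inequality.\<close>

lemma thompson_x1_simps:
  "0 \<le> t \<Longrightarrow> t \<le> 1/2 \<Longrightarrow> thompson_x1 t = t"
  "1/2 \<le> t \<Longrightarrow> t \<le> 3/4 \<Longrightarrow> thompson_x1 t = t / 2 + 1/4"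
  "3/4 \<le> t \<Longrightarrow> t \<le> 7/8 \<Longrightarrow> thompson_x1 t = t - 1/8"
  "7/8 \<le> t \<Longrightarrow> t \<le> 1 \<Longrightarrow> thompson_x1 t = 2 * t - 1"
  by (auto simp: thompson_x1_def)

text \<open>Halving \<open>t\<close> below \<open>1/2\<close>, or doubling \<open>1 - t\<close> by
  \<open>2 * t - 1\<close>, shifts the exponent of the normal form by one and keeps the word. For
  the rest let \<open>h\<close> be the word value. \<open>thompson_x0\<close> sends
  \<open>1/2 + h/4\<close> to \<open>(1 + h)/4\<close>, the first black vertex.
  \<open>thompson_x1\<close> sends it to \<open>1/2 + (h/2)/4\<close>, appending \<open>L\<close>,
  and sends the first white vertex \<open>3/4 + h/8\<close> to \<open>1/2 + ((1 + h)/2)/4\<close>,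
  appending \<open>R\<close>.\<close>

lemma model_arrow_value:
  assumes "(v, s, v') \<in> model_arrows thompson_x0 thompson_x1"
  shows "s \<in> {thompson_x0, thompson_x1}" "s (vertex_value v) = vertex_value v'"
proof -
  show "s \<in> {thompson_x0, thompson_x1}" using assms by cases auto
  from assms show "s (vertex_value v) = vertex_value v'"
  proof cases
    case (a_P k)
    \<comment> \<open>\<open>k = -1\<close> is the move from \<open>3/4\<close> to
      \<open>1/2\<close>; the other cases stay within the halving and the doubling piece.\<close>
    consider n where "k = int n" | "k = -1" | n where "k = - int n - 2"
      proof -
      have "k = int (nat k) \<or> k = -1 \<or> k = - int (nat (- k - 2)) - 2" by linarith
      then show thesis using that by blast
    qed
    then show ?thesis
    proof cases
      case (1 n)
      obtain p :: real where p: "2 ^ n = p" "1 \<le> p" by (rule power2_ge_one)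
      show ?thesis using 1 a_P p(2)
        by (simp add: p(1) thompson_x0_simps field_simps nat_add_distrib)
    next
      case 2
      then show ?thesis using a_P by (simp add: thompson_x0_simps)
    next
      case (3 n)
      obtain p :: real where p: "2 ^ n = p" "1 \<le> p" by (rule power2_ge_one)
      from 3 have "k = - int (Suc (Suc n))" "k + 1 = - int (Suc n)" by simp_all
      then have "vertex_value v = 1 - 1 / 2 ^ (n + 3)" "vertex_value v' = 1 - 1 / 2 ^ (n + 2)"
        unfolding a_P by (simp_all only: vertex_value_P_neg) (simp add: power_add)
      moreover have "thompson_x0 (1 - 1 / 2 ^ (n + 3)) = 1 - 1 / 2 ^ (n + 2)"
        using p(2) by (simp add: p(1) thompson_x0_simps field_simps power_add)
      ultimately show ?thesis using a_P(2) by (simp only:)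
    qed
  next
    case (a_White k w)
    then obtain n where k: "k = Suc n" by (cases k) auto
    obtain p :: real where p: "2 ^ n = p" "1 \<le> p" by (rule power2_ge_one)
    show ?thesis using k a_White word_value_bounds[of w] p(2)
      by (simp add: p(1) thompson_x0_simps field_simps)
  next
    case (a_White1 w)
    then show ?thesis using word_value_bounds[of w]
      by (simp add: thompson_x0_simps field_simps)
  next
    case (a_Gray w)
    then show ?thesis using word_value_bounds[of w]
      by (simp add: thompson_x0_simps field_simps)
  next
    case (a_Black k w)
    then obtain n where k: "k = Suc n" by (cases k) auto
    obtain p :: real where p: "2 ^ n = p" "1 \<le> p" by (rule power2_ge_one)
    show ?thesis using k a_Black word_value_bounds[of w] p(2)
      by (simp add: p(1) thompson_x0_simps field_simps)
  next
    case (b_P_nonneg k)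
    then obtain n where k: "k = int n" by (metis nonneg_int_cases)
    obtain p :: real where p: "2 ^ n = p" "1 \<le> p" by (rule power2_ge_one)
    show ?thesis using k b_P_nonneg p(2)
      by (simp add: p(1) thompson_x1_simps field_simps)
  next
    case b_P_minus1
    then show ?thesis by (simp add: thompson_x1_simps)
  next
    case (b_P_neg k)
    then obtain n where k: "k = int n + 1" by (intro that[of "nat (k - 1)"]) simp
    obtain p :: real where p: "2 ^ n = p" "1 \<le> p" by (rule power2_ge_one)
    from k have "- k - 1 = - int (Suc (Suc n))" "- k = - int (Suc n)" by simp_all
    then have "vertex_value v = 1 - 1 / 2 ^ (n + 3)" "vertex_value v' = 1 - 1 / 2 ^ (n + 2)"
      unfolding b_P_neg by (simp_all only: vertex_value_P_neg) (simp add: power_add)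
    moreover have "thompson_x1 (1 - 1 / 2 ^ (n + 3)) = 1 - 1 / 2 ^ (n + 2)"
      using p(2) by (simp add: p(1) thompson_x1_simps field_simps power_add)
    ultimately show ?thesis using b_P_neg(2) by (simp only:)
  next
    case (b_Gray w)
    then show ?thesis using word_value_bounds[of w]
      by (simp add: thompson_x1_simps field_simps)
  next
    case (b_White1 w)
    then show ?thesis using word_value_bounds[of w]
      by (simp add: thompson_x1_simps field_simps)
  next
    case (b_White k w)
    then obtain n where k: "k = Suc n" by (cases k) auto
    obtain p :: real where p: "2 ^ n = p" "1 \<le> p" by (rule power2_ge_one)
    show ?thesis using k b_White word_value_bounds[of w] p(2)
      by (simp add: p(1) thompson_x1_simps field_simps)
  next
    case (b_Black k w)
    then obtain n where k: "k = Suc n" by (cases k) auto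
    obtain p :: real where p: "2 ^ n = p" "1 \<le> p" by (rule power2_ge_one)
    show ?thesis using k b_Black word_value_bounds[of w] p(2)
      by (simp add: p(1) thompson_x1_simps field_simps)
  qed
qed

section \<open>Reflection of arrows and the isomorphism\<close>

lemma model_arrow_exists:
  assumes "v \<in> model_verts" "s \<in> {a, b}"
  obtains v' where "(v, s, v') \<in> model_arrows a b"
proof -
  have a: "\<exists>v'. (v, a, v') \<in> model_arrows a b"
    using assms(1)
  proof (cases v rule: model_verts_cases)
    case (White w n)
    then show ?thesis
      using model_arrows.a_White[of n w a b] model_arrows.a_White1[of w a b] by (cases n) auto
  next
    case (Black w n)
    then show ?thesis using model_arrows.a_Black[of "Suc n" w a b] by auto
  qed (blast intro: model_arrows.intros)+
  have b: "\<exists>v'. (v, b, v') \<in> model_arrows a b"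
    using assms(1)
  proof (cases v rule: model_verts_cases)
    case (P_nonneg n)
    then show ?thesis using model_arrows.b_P_nonneg[of "int n" b a] by auto
  next
    case (P_neg n)
    then show ?thesis
      using model_arrows.b_P_neg[of "int n" b a] model_arrows.b_P_minus1[of b a] by (cases n) auto
  next
    case (White w n)
    then show ?thesis
      using model_arrows.b_White[of n w b a] model_arrows.b_White1[of w b a] by (cases n) auto
  next
    case (Black w n)
    then show ?thesis using model_arrows.b_Black[of "Suc n" w b a] by auto
  qed (blast intro: model_arrows.intros)
  show ?thesis using that a b assms(2) by blast
qed

theorem proposition1:
  shows "\<exists>\<phi>. lgraph_iso
            (schreier_graph thompson_F {thompson_x0, thompson_x1} (\<lambda>f d. f d) dyadics01)
            (model_graph thompson_x0 thompson_x1) \<phi>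
          \<and> \<phi> (1/2) = P 0"
proof -
  \<comment> \<open>The explicit map runs from the model to the dyadics; the isomorphism is wanted
    in the other direction.\<close>
  define \<phi> where "\<phi> = inv_into model_verts vertex_value"
  have bij: "bij_betw vertex_value model_verts dyadics01"
    unfolding bij_betw_def
    using inj_on_vertex_value vertex_value_in_dyadics01 vertex_value_surj by blast
  have bij': "bij_betw \<phi> dyadics01 model_verts"
    unfolding \<phi>_def using bij by (rule bij_betw_inv_into)
  have \<phi>: "\<phi> x \<in> model_verts" "vertex_value (\<phi> x) = x" if "x \<in> dyadics01" for x
    using bij_betwE[OF bij'] bij_betw_inv_into_right[OF bij] that by (auto simp: \<phi>_def)
  have "(x, s, y) \<in> arrows (schreier_graph thompson_F {thompson_x0, thompson_x1} (\<lambda>f d. f d) dyadics01)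
      \<longleftrightarrow> (\<phi> x, s, \<phi> y) \<in> model_arrows thompson_x0 thompson_x1" (is "?A \<longleftrightarrow> ?B")
    if xy: "x \<in> dyadics01" "y \<in> dyadics01" for x y s
  proof
    assume ?A
    then have s: "s \<in> {thompson_x0, thompson_x1}" "s x = y" by (auto simp: schreier_graph_def)
    \<comment> \<open>The arrow given by totality ends at a vertex of value \<open>s x = y\<close>,
      and injectivity identifies it with \<open>\<phi> y\<close>.\<close>
    obtain v where v: "(\<phi> x, s, v) \<in> model_arrows thompson_x0 thompson_x1"
      using model_arrow_exists[OF \<phi>(1)[OF xy(1)] s(1)] .
    then have "vertex_value v = vertex_value (\<phi> y)"
      using model_arrow_value(2)[OF v] s \<phi> xy by simp
    then have "v = \<phi> y"
      using inj_onD[OF inj_on_vertex_value] model_arrows_verts[OF v] \<phi>(1) xy by blast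
    then show ?B using v by simp
  next
    assume ?B
    then show ?A
      using model_arrow_value[of "\<phi> x" s "\<phi> y"] \<phi> xy thompson_x0_in_F thompson_x1_in_F
      by (auto simp: schreier_graph_def)
  qed
  then have "lgraph_iso
      (schreier_graph thompson_F {thompson_x0, thompson_x1} (\<lambda>f d. f d) dyadics01)
      (model_graph thompson_x0 thompson_x1) \<phi>"
    using bij' by (auto simp: lgraph_iso_def schreier_graph_def model_graph_def)
  moreover have "\<phi> (1/2) = P 0"
    unfolding \<phi>_def
    by (rule inv_into_f_eq[OF inj_on_vertex_value]) (auto simp: model_verts_def)
  ultimately show ?thesis by blast
qed

end
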